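(* Let $T$ be a caterpillar with spine $S$, and let $m\ge 2$ be an integer. If $\Delta(T)\ge 4$ (i.e., $\deg(v)\ge 4$ for some vertex $v$ of $S$), then $\chi'_g(T;m,1)=\Delta(T)$.
   Context: A caterpillar is a finite tree $T$ in which there is a path $S$, called the spine, such that a vertex lies on $S$ if and only if its degree in $T$ is at least two; the spine is an induced subgraph of $T$. $\Delta(T)$ denotes the maximum degree of $T$. The $(m,1)$-edge coloring game on a finite simple graph $G$ with a set of colors $X$ is played alternately by two players, Maker and Breaker, with Maker playing first. On each turn Maker makes $m$ moves and Breaker makes one move; a move consists of coloring one uncolored edge of $G$ with a color from $X$ so that adjacent edges (edges sharing an endpoint) always receive distinct colors. Maker wins if eventually every edge is colored; Breaker wins if at some point the player who is to move cannot color any edge. The $(m,1)$-game chromatic index $\chi'_g(G;m,1)$ is the smallest nonnegative integer $k$ such that Maker has a winning strategy when $|X|=k$. *)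

theory Defs
  imports Main
begin

(* Graphs are given by a vertex set V and a set E of two-element subsets of V.
   The predicate tree of Graph_Theory is not applicable: its cycles are directed
   closed walks, so a symmetric digraph with at least one edge is never a tree there. *)

definition finite_simple_graph :: "'a set \<Rightarrow> 'a set set \<Rightarrow> bool" where
  "finite_simple_graph V E \<longleftrightarrow> finite V \<and> (\<forall>e\<in>E. e \<subseteq> V \<and> card e = 2)"

definition adjacent :: "'a set set \<Rightarrow> 'a \<Rightarrow> 'a \<Rightarrow> bool" where
  "adjacent E u v \<longleftrightarrow> {u, v} \<in> E"

definition degree :: "'a set set \<Rightarrow> 'a \<Rightarrow> nat" where
  "degree E v = card {e \<in> E. v \<in> e}"

definition max_degree :: "'a set \<Rightarrow> 'a set set \<Rightarrow> nat" where
  "max_degree V E = Max (degree E ` V)"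

definition connected_graph :: "'a set \<Rightarrow> 'a set set \<Rightarrow> bool" where
  "connected_graph V E \<longleftrightarrow> V \<noteq> {} \<and> (\<forall>u\<in>V. \<forall>v\<in>V. (adjacent E)\<^sup>*\<^sup>* u v)"

definition path :: "'a set \<Rightarrow> 'a set set \<Rightarrow> 'a list \<Rightarrow> bool" where
  "path V E p \<longleftrightarrow> set p \<subseteq> V \<and> distinct p \<and> successively (adjacent E) p"

definition cycle :: "'a set \<Rightarrow> 'a set set \<Rightarrow> 'a list \<Rightarrow> bool" where
  "cycle V E p \<longleftrightarrow> path V E p \<and> 3 \<le> length p \<and> adjacent E (last p) (hd p)"

definition finite_tree :: "'a set \<Rightarrow> 'a set set \<Rightarrow> bool" where
  "finite_tree V E \<longleftrightarrow>
     finite_simple_graph V E \<and> connected_graph V E \<and> (\<nexists>p. cycle V E p)"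

definition induced_path :: "'a set \<Rightarrow> 'a set set \<Rightarrow> 'a list \<Rightarrow> bool" where
  "induced_path V E p \<longleftrightarrow> path V E p \<and>
     (\<forall>i j. i < j \<and> j < length p \<and> adjacent E (p ! i) (p ! j) \<longrightarrow> j = Suc i)"

(* T = (V, E) is a caterpillar with spine S.  Since T is acyclic, every path in T
   is an induced one; requiring it here is no restriction. *)
definition caterpillar :: "'a set \<Rightarrow> 'a set set \<Rightarrow> 'a list \<Rightarrow> bool" where
  "caterpillar V E S \<longleftrightarrow> finite_tree V E \<and> induced_path V E S \<and>
     (\<forall>v\<in>V. v \<in> set S \<longleftrightarrow> 2 \<le> degree E v)"


type_synonym ('a, 'c) move = "'a set \<times> 'c"

(* The moves made so far, the most recent one first. *)
type_synonym ('a, 'c) history = "('a, 'c) move list"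

definition colored_edges :: "('a, 'c) history \<Rightarrow> 'a set set" where
  "colored_edges h = fst ` set h"

fun legal_move :: "'a set set \<Rightarrow> 'c set \<Rightarrow> ('a, 'c) history \<Rightarrow> ('a, 'c) move \<Rightarrow> bool" where
  "legal_move E X h (e, x) \<longleftrightarrow> e \<in> E \<and> e \<notin> colored_edges h \<and> x \<in> X \<and>
     (\<forall>(f, y) \<in> set h. e \<inter> f \<noteq> {} \<longrightarrow> x \<noteq> y)"

(* Every block of m + 1 consecutive moves consists of m moves of Maker followed by
   one move of Breaker. *)
definition maker_to_move :: "nat \<Rightarrow> ('a, 'c) history \<Rightarrow> bool" where
  "maker_to_move m h \<longleftrightarrow> length h mod (m + 1) < m"

(* The histories that can occur when Maker follows s, which may depend on the
   entire history, and Breaker makes arbitrary legal moves. *)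
inductive play_with ::
    "'a set set \<Rightarrow> 'c set \<Rightarrow> nat \<Rightarrow> (('a, 'c) history \<Rightarrow> ('a, 'c) move) \<Rightarrow> ('a, 'c) history \<Rightarrow> bool"
  for E X m s where
  start: "play_with E X m s []"
| maker: "play_with E X m s h \<Longrightarrow> maker_to_move m h \<Longrightarrow> legal_move E X h (s h)
    \<Longrightarrow> play_with E X m s (s h # h)"
| breaker: "play_with E X m s h \<Longrightarrow> \<not> maker_to_move m h \<Longrightarrow> legal_move E X h a
    \<Longrightarrow> play_with E X m s (a # h)"

(* As long as an edge is uncolored, the player to move can move (and, for Maker,
   s provides such a move).  Each move colors a new edge of the finite set E, so every
   play then ends with all edges colored. *)
definition winning_strategy ::
    "'a set set \<Rightarrow> 'c set \<Rightarrow> nat \<Rightarrow> (('a, 'c) history \<Rightarrow> ('a, 'c) move) \<Rightarrow> bool" where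
  "winning_strategy E X m s \<longleftrightarrow>
     (\<forall>h. play_with E X m s h \<and> colored_edges h \<noteq> E \<longrightarrow>
        (if maker_to_move m h then legal_move E X h (s h) else (\<exists>a. legal_move E X h a)))"

(* Only the number of colors matters, so {..<k} serves as the set of k colors.  The
   minimum exists for finite E: with more than card E colors no player is ever stuck. *)
definition game_chromatic_index :: "'a set set \<Rightarrow> nat \<Rightarrow> nat" where
  "game_chromatic_index E m = (LEAST k. \<exists>s. winning_strategy E {..<k} m s)"

end

theory Submission
  imports Defs
begin

text \<open>
  Call an edge inner if both its ends have degree at least two; every vertex of a caterpillar lies
  on at most two inner edges. With \<open>\<Delta>\<close> colors an edge that is not inner can always be colored, since
  it has at most \<open>\<Delta> - 1\<close> neighbors. Maker maintains that, whenever Breaker is to move, no uncolored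
  inner edge touches a colored edge that is not inner. A move of Breaker spoils this only if it colors
  an edge that is not inner, and then only for the at most two inner edges at the non-leaf end of that
  edge. These have at most three colored neighbors (two inner ones and Breaker's edge), so four
  colors and two moves suffice to color them at once. With the remaining moves Maker colors inner
  edges as long as there are any.
\<close>

section \<open>Inner edges and Maker's strategy\<close>

definition inner :: "'a set set \<Rightarrow> 'a set set" where
  "inner E = {e \<in> E. \<forall>v\<in>e. 2 \<le> degree E v}"

text \<open>Inner neighbors are not counted as threats: if every vertex lies on at most two inner
  edges, they block at most two colors at an inner edge.\<close>

definition threatened :: "'a set set \<Rightarrow> 'a set set \<Rightarrow> 'a set set" where
  "threatened E C = {e \<in> inner E - C. \<exists>f \<in> C - inner E. e \<inter> f \<noteq> {}}"

text \<open>The choice of color is left to \<open>SOME\<close>: any legal color will do, since the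
  invariant kept by Maker depends only on the set of colored edges and the number of moves.\<close>

definition maker_strategy ::
    "'a set set \<Rightarrow> 'c set \<Rightarrow> ('a, 'c) history \<Rightarrow> ('a, 'c) move" where
  "maker_strategy E X h =
     (let C = colored_edges h;
          F = (if threatened E C \<noteq> {} then threatened E C
               else if inner E - C \<noteq> {} then inner E - C else E - C)
      in SOME a. fst a \<in> F \<and> legal_move E X h a)"

section \<open>Finite simple graphs\<close>

lemma finite_simple_graph_finite_edges:
  assumes "finite_simple_graph V E"
  shows "finite E"
  using assms unfolding finite_simple_graph_def
  by (meson PowI finite_Pow_iff finite_subset subsetI)

lemma finite_simple_graph_edgeE:
  assumes "finite_simple_graph V E" "e \<in> E" "u \<in> e"
  obtains v where "e = {u, v}" "v \<noteq> u" "u \<in> V" "v \<in> V"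
proof -
  have "card e = 2" "e \<subseteq> V"
    using assms by (auto simp: finite_simple_graph_def)
  then obtain a b where "e = {a, b}" "a \<noteq> b"
    by (auto simp: card_2_iff)
  with \<open>u \<in> e\<close> have "e = {u, a} \<and> a \<noteq> u \<or> e = {u, b} \<and> b \<noteq> u"
    by blast
  with \<open>e \<subseteq> V\<close> that show thesis
    by blast
qed

lemma degree_le_max_degree:
  assumes "finite V" "v \<in> V"
  shows "degree E v \<le> max_degree V E"
  using assms by (simp add: max_degree_def)

section \<open>Legal moves and proper histories\<close>

text \<open>Pigeonhole. Distinctness of the edges in \<open>h\<close> ensures that each colored
  neighbor blocks only one color.\<close>

lemma legal_move_exists:
  assumes "distinct (map fst h)" "e \<in> E" "e \<notin> colored_edges h" "finite X"
    and less: "card {f \<in> colored_edges h. e \<inter> f \<noteq> {}} < card X"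
  shows "\<exists>x. legal_move E X h (e, x)"
proof -
  define A where "A = {a \<in> set h. e \<inter> fst a \<noteq> {}}"
  have "inj_on fst A"
    using assms(1) by (auto simp: A_def distinct_map intro: inj_on_subset)
  then have "card A = card (fst ` A)"
    by (simp add: card_image)
  also have "fst ` A = {f \<in> colored_edges h. e \<inter> f \<noteq> {}}"
    by (auto simp: A_def colored_edges_def)
  finally have "card (snd ` A) < card X"
    using less card_image_le[of A snd] by (simp add: A_def)
  moreover have "finite (snd ` A)"
    by (simp add: A_def)
  ultimately have "\<not> X \<subseteq> snd ` A"
    using card_mono leD by blast
  then obtain x where "x \<in> X" "x \<notin> snd ` A"
    by blast
  then have "legal_move E X h (e, x)"
    using assms(2,3) unfolding legal_move.simps A_def by (force simp: image_iff)
  then show ?thesis ..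
qed

text \<open>A proper partial edge coloring, recorded as a list of moves. The conclusion
  \<open>a = b\<close> allows for a nonempty edge meeting itself.\<close>

definition proper_history :: "'a set set \<Rightarrow> 'c set \<Rightarrow> ('a, 'c) history \<Rightarrow> bool" where
  "proper_history E X h \<longleftrightarrow> distinct (map fst h) \<and> colored_edges h \<subseteq> E \<and> snd ` set h \<subseteq> X \<and>
     (\<forall>a\<in>set h. \<forall>b\<in>set h. fst a \<inter> fst b \<noteq> {} \<and> snd a = snd b \<longrightarrow> a = b)"

lemma proper_history_Cons:
  assumes "proper_history E X h" "legal_move E X h a"
  shows "proper_history E X (a # h)"
proof -
  obtain e x where a: "a = (e, x)" by (cases a)
  have new: "e \<in> E" "e \<notin> colored_edges h" "x \<in> X"
    "\<And>b. b \<in> set h \<Longrightarrow> e \<inter> fst b \<noteq> {} \<Longrightarrow> x \<noteq> snd b"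
    using assms(2) unfolding a legal_move.simps by (blast, blast, blast, fastforce)
  show ?thesis
    unfolding proper_history_def
  proof (intro conjI ballI impI)
    fix b c assume "b \<in> set (a # h)" "c \<in> set (a # h)"
      "fst b \<inter> fst c \<noteq> {} \<and> snd b = snd c"
    moreover have "fst c \<inter> fst b = fst b \<inter> fst c"
      by blast
    moreover have "\<not> (d \<in> set h \<and> fst a \<inter> fst d \<noteq> {} \<and> snd a = snd d)" for d
      using new(4)[of d] by (auto simp: a)
    \<comment> \<open>Here \<open>calculation(3)\<close> is the assumption that \<open>b\<close> and
      \<open>c\<close> have adjacent edges and equal colors.\<close>
    moreover have "b = c" if "b \<in> set h" "c \<in> set h"
      using that calculation(3) assms(1) unfolding proper_history_def by blast
    ultimately show "b = c"
      unfolding list.set insert_iff by metis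
  qed (use assms(1) new(1-3) in \<open>simp_all add: proper_history_def a colored_edges_def\<close>)
qed

lemma proper_historyD:
  assumes "proper_history E X h"
  shows "distinct (map fst h)" "colored_edges h \<subseteq> E"
  using assms by (simp_all add: proper_history_def)

lemma play_with_proper_history:
  assumes "play_with E X m s h"
  shows "proper_history E X h"
  using assms
proof induction
  case start
  then show ?case by (simp add: proper_history_def colored_edges_def)
qed (auto intro: proper_history_Cons)

lemma proper_history_length:
  assumes "proper_history E X h"
  shows "card (colored_edges h) = length h"
  using assms distinct_card[of "map fst h"]
  by (simp add: proper_history_def colored_edges_def)

section \<open>The lower bound by vertex degrees\<close>

text \<open>As long as an edge is uncolored, the play can be extended, and its length equals the
  number of colored edges. Hence a play of length \<open>card E\<close> is reached, and it colors
  everything.\<close>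

lemma winning_strategy_completes:
  assumes win: "winning_strategy E X m s" and fin: "finite E"
  obtains h where "play_with E X m s h" "colored_edges h = E"
proof -
  have "\<exists>h. play_with E X m s h \<and> length h = n" if "n \<le> card E" for n
    using that
  proof (induction n)
    case 0
    then show ?case using play_with.start by auto
  next
    case (Suc n)
    then obtain h where h: "play_with E X m s h" "length h = n"
      by auto
    then have "card (colored_edges h) = n"
      using play_with_proper_history proper_history_length by blast
    then have "colored_edges h \<noteq> E"
      using Suc.prems by auto
    then have "if maker_to_move m h then legal_move E X h (s h) else (\<exists>a. legal_move E X h a)"
      using win h(1) unfolding winning_strategy_def by blast
    then obtain a where "play_with E X m s (a # h)"
      using play_with.maker[OF h(1)] play_with.breaker[OF h(1)]
      by (cases "maker_to_move m h") (auto simp del: legal_move.simps)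
    then show ?case
      using h by (metis length_Cons)
  qed
  then obtain h where h: "play_with E X m s h" "length h = card E"
    by blast
  then have proper: "proper_history E X h"
    by (simp add: play_with_proper_history)
  have "colored_edges h \<subseteq> E" "card (colored_edges h) = card E"
    using h(2) proper_history_length[OF proper] proper_historyD(2)[OF proper] by auto
  then have "colored_edges h = E"
    using fin by (simp add: card_subset_eq)
  with h that show thesis by blast
qed

text \<open>In a completed play the edges at \<open>v\<close> carry pairwise distinct
  colors.\<close>

lemma winning_strategy_degree_le:
  assumes "winning_strategy E X m s" "finite E" "finite X"
  shows "degree E v \<le> card X"
proof -
  obtain h where h: "play_with E X m s h" "colored_edges h = E"
    using winning_strategy_completes assms by blast
  define A where "A = {a \<in> set h. v \<in> fst a}"
  have proper: "proper_history E X h"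
    using h by (simp add: play_with_proper_history)
  have "{e \<in> E. v \<in> e} = fst ` A"
    using h(2) by (auto simp: A_def colored_edges_def)
  then have "degree E v \<le> card A"
    by (simp add: degree_def card_image_le A_def)
  also have "inj_on snd A"
  proof (rule inj_onI)
    fix a b assume "a \<in> A" "b \<in> A" "snd a = snd b"
    moreover from this have "fst a \<inter> fst b \<noteq> {}"
      by (auto simp: A_def)
    ultimately show "a = b"
      using proper unfolding A_def proper_history_def by blast
  qed
  then have "card A = card (snd ` A)"
    by (simp add: card_image)
  also have "\<dots> \<le> card X"
    using proper \<open>finite X\<close> by (intro card_mono) (auto simp: A_def proper_history_def)
  finally show ?thesis .
qed

section \<open>Colorability of a single edge\<close>

text \<open>An end of degree below two lies on \<open>e\<close> alone, so every neighbor of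
  \<open>e\<close> passes through the other end \<open>v\<close>.\<close>

lemma non_innerE:
  assumes "finite_simple_graph V E" "e \<in> E" "e \<notin> inner E"
  obtains u v where "e = {u, v}" "v \<in> V" "\<And>f. f \<in> E \<Longrightarrow> u \<in> f \<Longrightarrow> f = e"
proof -
  obtain u where u: "u \<in> e" "degree E u < 2"
    using assms by (auto simp: inner_def not_le)
  obtain v where v: "e = {u, v}" "v \<in> V"
    using finite_simple_graph_edgeE[OF assms(1,2) u(1)] by metis
  have "card {f \<in> E. u \<in> f} \<le> Suc 0" "finite {f \<in> E. u \<in> f}"
    using u finite_simple_graph_finite_edges[OF assms(1)] by (auto simp: degree_def)
  then have "f = e" if "f \<in> E" "u \<in> f" for f
    using that u(1) assms(2) by (auto simp: card_le_Suc0_iff_eq)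
  with v that show thesis by blast
qed

text \<open>All colored neighbors of \<open>e\<close> lie among the other edges at \<open>v\<close>,
  so they number less than \<open>degree E v\<close>.\<close>

lemma legal_move_non_inner:
  assumes G: "finite_simple_graph V E" and "finite X" "max_degree V E \<le> card X"
    and "proper_history E X h" "e \<in> E - colored_edges h" "e \<notin> inner E"
  shows "\<exists>x. legal_move E X h (e, x)"
proof (rule legal_move_exists)
  have E: "e \<in> E" using assms by simp
  obtain u v where uv: "e = {u, v}" "v \<in> V" "\<And>f. f \<in> E \<Longrightarrow> u \<in> f \<Longrightarrow> f = e"
    using non_innerE[OF G E \<open>e \<notin> inner E\<close>] by metis
  have "v \<in> f" if f: "f \<in> colored_edges h" "e \<inter> f \<noteq> {}" for f
  proof -
    have "f \<in> E" "f \<noteq> e"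
      using assms(5) f proper_historyD(2)[OF assms(4)] by auto
    then have "u \<notin> f"
      using uv(3) by blast
    then show ?thesis
      using f uv(1) by blast
  qed
  then have "{f \<in> colored_edges h. e \<inter> f \<noteq> {}} \<subseteq> {f \<in> E. v \<in> f} - {e}"
    using assms(5) proper_historyD(2)[OF assms(4)] by auto
  moreover have "e \<in> {f \<in> E. v \<in> f}"
    using E uv(1) by simp
  ultimately have sub: "{f \<in> colored_edges h. e \<inter> f \<noteq> {}} \<subset> {f \<in> E. v \<in> f}"
    by blast
  have "card {f \<in> colored_edges h. e \<inter> f \<noteq> {}} < degree E v"
    unfolding degree_def
    using finite_simple_graph_finite_edges[OF G] by (intro psubset_card_mono[OF _ sub]) simp
  also have "\<dots> \<le> card X"
    using degree_le_max_degree[of V v E] G uv(2) assms(3) by (simp add: finite_simple_graph_def)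
  finally show "card {f \<in> colored_edges h. e \<inter> f \<noteq> {}} < card X" .
qed (use assms(2,5) proper_historyD(1)[OF assms(4)] in auto)

text \<open>At most three colors are blocked: one by a further inner edge at each end, and one by
  \<open>g\<close>.\<close>

lemma legal_move_inner:
  assumes G: "finite_simple_graph V E" and "finite X" "4 \<le> card X"
    and two: "\<And>v. card {e \<in> inner E. v \<in> e} \<le> 2"
    and h: "proper_history E X h" and e: "e \<in> inner E - colored_edges h"
    and only: "\<And>f. f \<in> colored_edges h - inner E \<Longrightarrow> e \<inter> f \<noteq> {} \<Longrightarrow> f = g"
  shows "\<exists>x. legal_move E X h (e, x)"
proof (rule legal_move_exists)
  have fin: "finite (inner E)"
    using finite_simple_graph_finite_edges[OF G] by (simp add: inner_def)
  have E: "e \<in> E" "e \<in> inner E" "e \<notin> colored_edges h" using e by (auto simp: inner_def)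
  have "card e = 2"
    using G E by (simp add: finite_simple_graph_def)
  then obtain u v where uv: "e = {u, v}"
    by (auto simp: card_2_iff)
  define N where "N w = {f \<in> inner E. w \<in> f} - {e}" for w
  have N: "card (N w) \<le> 1" if "w \<in> e" for w
    using two[of w] E that fin by (simp add: N_def card_Diff_singleton)
  have "{f \<in> colored_edges h. e \<inter> f \<noteq> {}} \<subseteq> insert g (N u \<union> N v)"
    using only E by (auto simp: N_def uv)
  then have "card {f \<in> colored_edges h. e \<inter> f \<noteq> {}} \<le> card (insert g (N u \<union> N v))"
    using fin by (intro card_mono) (auto simp: N_def)
  also have "\<dots> \<le> Suc (card (N u) + card (N v))"
    using card_insert_le_m1[of "Suc (card (N u) + card (N v))" "N u \<union> N v" g]
      card_Un_le[of "N u" "N v"] by simp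
  also have "\<dots> < card X"
    using N[of u] N[of v] uv \<open>4 \<le> card X\<close> by simp
  finally show "card {f \<in> colored_edges h. e \<inter> f \<noteq> {}} < card X" .
qed (use e \<open>finite X\<close> proper_historyD(1)[OF h] in \<open>auto simp: inner_def\<close>)

section \<open>Maker's invariant\<close>

text \<open>
  The edge \<open>g\<close> is the last one colored by Breaker; truncated subtraction makes the bound on the
  number of threatened edges vanish from Maker's third move of a turn on.
\<close>

definition controlled :: "'a set set \<Rightarrow> nat \<Rightarrow> ('a, 'c) history \<Rightarrow> bool" where
  "controlled E m h \<longleftrightarrow>
     card (threatened E (colored_edges h)) \<le> 2 - length h mod (m + 1) \<and>
     (\<exists>g. \<forall>e \<in> inner E - colored_edges h. \<forall>f \<in> colored_edges h - inner E.
        e \<inter> f \<noteq> {} \<longrightarrow> f = g)"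

text \<open>The claim does not depend on whose turn it is: it supplies Maker's moves and also shows
  that Breaker is never stuck.\<close>

lemma legal_move_controlled:
  assumes "finite_simple_graph V E" "finite X" "4 \<le> card X" "max_degree V E \<le> card X"
    and "\<And>v. card {e \<in> inner E. v \<in> e} \<le> 2"
    and "proper_history E X h" "controlled E m h" "e \<in> E - colored_edges h"
  shows "\<exists>x. legal_move E X h (e, x)"
proof (cases "e \<in> inner E")
  case True
  obtain g where "\<And>f. f \<in> colored_edges h - inner E \<Longrightarrow> e \<inter> f \<noteq> {} \<Longrightarrow> f = g"
    using assms(7,8) True by (auto simp: controlled_def)
  with True assms show ?thesis
    by (intro legal_move_inner[where g = g]) auto
next
  case False
  with assms show ?thesis
    by (intro legal_move_non_inner) auto
qed

text \<open>The set from which the strategy picks is nonempty and consists of uncolored edges, each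
  with a legal color, so \<open>SOME\<close> has a witness. Threatened edges are themselves inner
  and uncolored, which gives the last claim.\<close>

lemma maker_strategy_legal:
  assumes legal: "\<And>e. e \<in> E - colored_edges h \<Longrightarrow> \<exists>x. legal_move E X h (e, x)"
    and "colored_edges h \<subset> E"
  defines "C \<equiv> colored_edges h"
  shows "legal_move E X h (maker_strategy E X h)"
    and "threatened E C \<noteq> {} \<Longrightarrow> fst (maker_strategy E X h) \<in> threatened E C"
    and "inner E - C \<noteq> {} \<Longrightarrow> fst (maker_strategy E X h) \<in> inner E - C"
proof -
  define F where "F = (if threatened E C \<noteq> {} then threatened E C
     else if inner E - C \<noteq> {} then inner E - C else E - C)"
  have sub: "threatened E C \<subseteq> inner E - C" "inner E \<subseteq> E"
    by (auto simp: threatened_def inner_def)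
  have "F \<noteq> {}" "F \<subseteq> E - C"
    using sub assms(2) by (auto simp: F_def C_def)
  then obtain e where "e \<in> F" "e \<in> E - C"
    by blast
  then have "\<exists>a. fst a \<in> F \<and> legal_move E X h a"
    using legal C_def by force
  from someI_ex[OF this] have F: "fst (maker_strategy E X h) \<in> F"
    and "legal_move E X h (maker_strategy E X h)"
    unfolding maker_strategy_def F_def C_def Let_def by auto
  then show "legal_move E X h (maker_strategy E X h)"
    by simp
  show "fst (maker_strategy E X h) \<in> threatened E C" if "threatened E C \<noteq> {}"
    using F that by (simp add: F_def)
  show "fst (maker_strategy E X h) \<in> inner E - C" if "inner E - C \<noteq> {}"
    using F that sub by (auto simp: F_def split: if_splits)
qed

lemma colored_edges_Cons [simp]: "colored_edges (a # h) = insert (fst a) (colored_edges h)"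
  by (simp add: colored_edges_def)

text \<open>Coloring an inner edge creates no threat and, if there are threats, removes one, while
  the bound drops by at most one. Once no inner edge is uncolored, nothing can be
  threatened.\<close>

lemma controlled_maker_move:
  assumes fin: "finite E" and h: "controlled E m h" and maker: "maker_to_move m h"
    and t: "threatened E (colored_edges h) \<noteq> {} \<Longrightarrow> fst a \<in> threatened E (colored_edges h)"
    and i: "inner E - colored_edges h \<noteq> {} \<Longrightarrow> fst a \<in> inner E - colored_edges h"
  shows "controlled E m (a # h)"
proof (cases "inner E - colored_edges h = {}")
  case True
  then have "threatened E (colored_edges (a # h)) = {}"
    by (auto simp: threatened_def)
  with True show ?thesis
    by (auto simp: controlled_def)
next
  case False
  let ?C = "colored_edges h"
  have a: "fst a \<in> inner E" using i False by simp
  have eq: "threatened E (colored_edges (a # h)) = threatened E ?C - {fst a}"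
    using a by (auto simp: threatened_def)
  have fin': "finite (threatened E ?C)"
    using fin by (simp add: threatened_def inner_def)
  \<comment> \<open>No wraparound: the residue is below \<open>m\<close> when Maker moves.\<close>
  have "Suc (length h) mod (m + 1) = Suc (length h mod (m + 1))"
    using maker by (simp add: maker_to_move_def mod_Suc)
  moreover have "card (threatened E ?C - {fst a}) = card (threatened E ?C) - 1"
    using t fin' by (cases "threatened E ?C = {}") auto
  moreover have "card (threatened E ?C) \<le> 2 - length h mod (m + 1)"
    using h by (simp only: controlled_def)
  ultimately have "card (threatened E (colored_edges (a # h))) \<le> 2 - length (a # h) mod (m + 1)"
    unfolding eq length_Cons by linarith
  then show ?thesis
    using h a by (auto simp: controlled_def)
qed

text \<open>At Breaker's turn the bound is \<open>2 - m\<close>, which is zero, so all new threats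
  come from Breaker's edge, the new \<open>g\<close>. They meet at its non-leaf end, and the bound
  restarts at two.\<close>

lemma controlled_breaker_move:
  assumes G: "finite_simple_graph V E" and "2 \<le> m"
    and two: "\<And>v. card {e \<in> inner E. v \<in> e} \<le> 2"
    and h: "controlled E m h" and breaker: "\<not> maker_to_move m h" and a: "fst a \<in> E"
  shows "controlled E m (a # h)"
proof -
  let ?C = "colored_edges h"
  have fin: "finite (inner E)"
    using finite_simple_graph_finite_edges[OF G] by (simp add: inner_def)
  have r: "length h mod (m + 1) = m"
    using breaker mod_less_divisor[of "m + 1" "length h"] unfolding maker_to_move_def by linarith
  then have "card (threatened E ?C) = 0"
    using h \<open>2 \<le> m\<close> by (simp add: controlled_def)
  then have safe: "threatened E ?C = {}"
    using fin by (simp add: threatened_def)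
  have sub: "threatened E (insert (fst a) ?C) \<subseteq> {e \<in> inner E. fst a \<notin> inner E \<and> e \<inter> fst a \<noteq> {}}"
    using safe by (auto simp: threatened_def)
  have "card (threatened E (insert (fst a) ?C)) \<le> 2"
  proof (cases "fst a \<in> inner E")
    case True
    then have "threatened E (insert (fst a) ?C) = {}"
      using sub by blast
    then show ?thesis by simp
  next
    case False
    obtain u v where uv: "fst a = {u, v}" "\<And>f. f \<in> E \<Longrightarrow> u \<in> f \<Longrightarrow> f = fst a"
      using non_innerE[OF G a False] by metis
    have "v \<in> e" if "e \<in> inner E" "e \<inter> fst a \<noteq> {}" for e
    proof -
      have "u \<notin> e"
        using that(1) uv(2)[of e] False by (auto simp: inner_def)
      then show ?thesis
        using that(2) by (simp add: uv(1))
    qed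
    then have "threatened E (insert (fst a) ?C) \<subseteq> {e \<in> inner E. v \<in> e}"
      using sub by blast
    then have "card (threatened E (insert (fst a) ?C)) \<le> card {e \<in> inner E. v \<in> e}"
      using fin by (intro card_mono) auto
    then show ?thesis using two[of v] by simp
  qed
  moreover have "Suc (length h) mod (m + 1) = 0"
    using r by (simp add: mod_Suc)
  moreover have "f = fst a"
    if "e \<in> inner E - insert (fst a) ?C" "f \<in> insert (fst a) ?C - inner E" "e \<inter> f \<noteq> {}" for e f
    using that safe by (auto simp: threatened_def)
  ultimately show ?thesis
    unfolding controlled_def colored_edges_Cons length_Cons
    by (intro conjI exI[of _ "fst a"] ballI impI) simp
qed

text \<open>The invariant is shown along every play, and legality is then read off from it. The
  shape of the caterpillar enters through \<open>two\<close>.\<close>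

lemma maker_strategy_winning:
  assumes G: "finite_simple_graph V E" and X: "finite X" "4 \<le> card X" "max_degree V E \<le> card X"
    and m: "2 \<le> m" and two: "\<And>v. card {e \<in> inner E. v \<in> e} \<le> 2"
  shows "winning_strategy E X m (maker_strategy E X)"
proof -
  have legal: "\<exists>x. legal_move E X h (e, x)"
    if "proper_history E X h" "controlled E m h" "e \<in> E - colored_edges h" for h e
    using legal_move_controlled[OF G X two] that by blast
  have controlled: "controlled E m h" if "play_with E X m (maker_strategy E X) h" for h
    using that
  proof induction
    case start
    show ?case by (simp add: controlled_def threatened_def colored_edges_def)
  next
    case (maker h)
    have h: "proper_history E X h"
      using maker.hyps play_with_proper_history by blast
    \<comment> \<open>The rule for Maker already presupposes a legal move; this yields the uncolored
      edge that \<open>maker_strategy_legal\<close> asks for.\<close>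
    have "fst (maker_strategy E X h) \<in> E - colored_edges h"
      using maker.hyps by (cases "maker_strategy E X h") auto
    then have "colored_edges h \<subset> E"
      using proper_historyD(2)[OF h] by auto
    note strategy = maker_strategy_legal(2,3)[OF legal[OF h maker.IH] this]
    show ?case
      by (rule controlled_maker_move[OF finite_simple_graph_finite_edges[OF G] maker.IH
            \<open>maker_to_move m h\<close> strategy])
  next
    case (breaker h a)
    then have "fst a \<in> E" by (cases a) auto
    with breaker show ?case
      using controlled_breaker_move[OF G m two] by blast
  qed
  have "if maker_to_move m h then legal_move E X h (maker_strategy E X h)
      else (\<exists>a. legal_move E X h a)"
    if play: "play_with E X m (maker_strategy E X) h" and "colored_edges h \<noteq> E" for h
  proof -
    have h: "proper_history E X h" "controlled E m h"
      using play play_with_proper_history controlled by blast+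
    then have "colored_edges h \<subset> E"
      using that proper_historyD(2)[OF h(1)] by auto
    moreover from this obtain e where "e \<in> E - colored_edges h"
      by blast
    ultimately show ?thesis
      using maker_strategy_legal(1)[OF legal[OF h]] legal[OF h, of e]
      by (cases "maker_to_move m h") (simp_all del: legal_move.simps, blast)
  qed
  then show ?thesis
    unfolding winning_strategy_def by blast
qed

section \<open>Inner edges of caterpillars\<close>

text \<open>Both ends of an inner edge lie on the spine, and since the spine is induced, they are
  consecutive there.\<close>

lemma caterpillar_inner_edges_le_2:
  assumes "caterpillar V E S"
  shows "card {e \<in> inner E. v \<in> e} \<le> 2"
proof (cases "v \<in> set S")
  case True
  have G: "finite_simple_graph V E" and P: "induced_path V E S"
    and S: "\<And>w. w \<in> V \<Longrightarrow> w \<in> set S \<longleftrightarrow> 2 \<le> degree E w"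
    using assms by (auto simp: caterpillar_def finite_tree_def)
  obtain i where i: "i < length S" "S ! i = v"
    using True by (auto simp: in_set_conv_nth)
  \<comment> \<open>At an end of the spine \<open>S ! Suc i\<close> may be out of range, or
    \<open>i - 1\<close> may equal \<open>i\<close>. This is harmless, as the set only has to
    contain all inner edges at \<open>v\<close>.\<close>
  have "e \<in> {{v, S ! Suc i}, {v, S ! (i - 1)}}" if e: "e \<in> inner E" "v \<in> e" for e
  proof -
    have "e \<in> E" using e by (simp add: inner_def)
    then obtain w where w: "e = {v, w}" "w \<noteq> v" "w \<in> V"
      using finite_simple_graph_edgeE[OF G _ e(2)] by metis
    then have "w \<in> set S"
      using S e by (simp add: inner_def)
    then obtain j where j: "j < length S" "S ! j = w"
      by (auto simp: in_set_conv_nth)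
    \<comment> \<open>Both orientations are needed because \<open>induced_path\<close> speaks only
      of increasing indices.\<close>
    have "adjacent E (S ! i) (S ! j)" "adjacent E (S ! j) (S ! i)"
      using \<open>e \<in> E\<close> i j w by (auto simp: adjacent_def insert_commute)
    moreover have "i \<noteq> j" using i j w by auto
    ultimately have "j = Suc i \<or> i = Suc j"
      using P i j by (meson induced_path_def linorder_neqE_nat)
    then show ?thesis using w j by auto
  qed
  then have "card {e \<in> inner E. v \<in> e} \<le> card {{v, S ! Suc i}, {v, S ! (i - 1)}}"
    by (intro card_mono) auto
  also have "\<dots> \<le> 2"
    by (simp add: card_insert_if)
  finally show ?thesis .
next
  case False
  have "e \<subseteq> V" if "e \<in> inner E" for e
    using that assms
    by (auto simp: inner_def caterpillar_def finite_tree_def finite_simple_graph_def)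
  then have "{e \<in> inner E. v \<in> e} = {}"
    using False assms by (auto simp: inner_def caterpillar_def)
  then show ?thesis
    by (simp only: card.empty zero_le)
qed

theorem theorem3p1:
  fixes V :: "'a set" and E :: "'a set set" and S :: "'a list" and m :: nat
  assumes "caterpillar V E S"
    and "2 \<le> m"
    and "4 \<le> max_degree V E"
  shows "game_chromatic_index E m = max_degree V E"
  unfolding game_chromatic_index_def
proof (rule Least_equality)
  have G: "finite_simple_graph V E" and "V \<noteq> {}"
    using assms(1) by (auto simp: caterpillar_def finite_tree_def connected_graph_def)
  then have "finite V" "finite E"
    using finite_simple_graph_finite_edges by (auto simp: finite_simple_graph_def)
  show "\<exists>s. winning_strategy E {..<max_degree V E} m s"
    using assms(3)
    by (intro exI[of _ "maker_strategy E {..<max_degree V E}"]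
        maker_strategy_winning[OF G _ _ _ assms(2) caterpillar_inner_edges_le_2[OF assms(1)]]) simp_all
  show "max_degree V E \<le> k" if "\<exists>s. winning_strategy E {..<k} m s" for k
  proof -
    have "degree E v \<le> k" for v
      using that winning_strategy_degree_le[of E "{..<k}", OF _ \<open>finite E\<close>] by auto
    then show ?thesis
      using \<open>finite V\<close> \<open>V \<noteq> {}\<close> by (simp add: max_degree_def)
  qed
qed

end
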